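(* Let $\Omega = \Omega_{1}\times\Omega_{2}\subset \mathbb{C}^{2}$ be a bounded product domain ($\Omega_1,\Omega_2$ bounded domains in $\mathbb{C}$) such that $\overline{\mathbb{C}}\setminus\Omega_{1}$ has a finite number of connected components and none of them is a singleton. Assume that $\Omega_{2}$ is a simply connected domain in $\mathbb{C}$. Then for $z=(z_{1}, z_{2})\in\Omega$, $$\lim_{z_{1}\to\partial\Omega_{1}}T_{\Omega}(z) = 1.$$
   Context: $\overline{\mathbb{C}}$ is the Riemann sphere, $\mathbb{D}^n$ is the unit polydisk in $\mathbb{C}^n$, and $\mathbb{D}^n(0,r)$ is the polydisk centered at the origin with radius $r$ (all coordinates of modulus less than $r$). Let $\Omega\subset\mathbb{C}^n$ be a bounded domain. A holomorphic embedding $f:\Omega\to\mathbb{D}^n$ means an injective holomorphic map. The squeezing function corresponding to the polydisk on $\Omega$ is $$T_{\Omega}(z):=\sup_f\{r:\mathbb{D}^n(0,r)\subseteq f(\Omega)\},\qquad z\in\Omega,$$ where the supremum is taken over all holomorphic embeddings $f:\Omega\to\mathbb{D}^n$ with $f(z)=0$. The limit means that, for $z_2\in\Omega_2$, $T_\Omega(z_1,z_2)\to 1$ as $z_1\in\Omega_1$ tends to the boundary $\partial\Omega_1$ (the Euclidean distance from $z_1$ to $\partial\Omega_1$ tends to $0$). *)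

theory Defs
  imports "HOL-Analysis.Analysis"
begin

definition is_domain :: "'a::topological_space set \<Rightarrow> bool" where
  "is_domain S \<longleftrightarrow> open S \<and> connected S \<and> S \<noteq> {}"

text \<open>The Riemann sphere as the one-point compactification of the plane: \<open>None\<close> is the point
  at infinity, and \<open>Some z\<close> is the finite point \<open>z\<close>.\<close>

abbreviation riemann_sphere :: "complex option topology" where
  "riemann_sphere \<equiv> Alexandroff_compactification euclidean"

definition sphere_complement_components :: "complex set \<Rightarrow> complex option set set" where
  "sphere_complement_components S =
     connected_components_of
       (subtopology riemann_sphere (topspace riemann_sphere - Some ` S))"

text \<open>The norm on \<open>complex ^ 'n\<close> is the Euclidean one, so polydisks are not norm balls.\<close>

definition polydisk :: "real \<Rightarrow> (complex ^ 'n) set" where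
  "polydisk r = {w. \<forall>i. cmod (w $ i) < r}"

text \<open>Holomorphy in several variables: the Frechet derivative exists and is complex linear.\<close>

definition holomorphic_map_on ::
    "(complex ^ 'n \<Rightarrow> complex ^ 'm) \<Rightarrow> (complex ^ 'n) set \<Rightarrow> bool" where
  "holomorphic_map_on f S \<longleftrightarrow>
     (\<forall>z\<in>S. \<exists>D. (f has_derivative D) (at z within S) \<and> (\<forall>c v. D (c *s v) = c *s D v))"

definition holomorphic_embedding ::
    "(complex ^ 'n \<Rightarrow> complex ^ 'm) \<Rightarrow> (complex ^ 'n) set \<Rightarrow> (complex ^ 'm) set \<Rightarrow> bool" where
  "holomorphic_embedding f S U \<longleftrightarrow> holomorphic_map_on f S \<and> inj_on f S \<and> f ` S \<subseteq> U"

text \<open>Only positive radii are admitted: for \<open>r \<le> 0\<close> the polydisk is empty. The supremum is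
  taken in the reals; it is a genuine one for bounded open \<open>S\<close> and \<open>z \<in> S\<close> by the two lemmas
  below.\<close>

definition polydisk_squeezing :: "(complex ^ 'n) set \<Rightarrow> complex ^ 'n \<Rightarrow> real" where
  "polydisk_squeezing S z =
     Sup {r. 0 < r \<and> (\<exists>f :: complex ^ 'n \<Rightarrow> complex ^ 'n.
            holomorphic_embedding f S (polydisk 1) \<and> f z = 0 \<and> polydisk r \<subseteq> f ` S)}"

lemma polydisk_squeezing_bdd_above:
  fixes S :: "(complex ^ 'n) set"
  shows "bdd_above {r. 0 < r \<and> (\<exists>f :: complex ^ 'n \<Rightarrow> complex ^ 'n.
            holomorphic_embedding f S (polydisk 1) \<and> f z = 0 \<and> polydisk r \<subseteq> f ` S)}"
proof (rule bdd_aboveI[where M = 1], clarify)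
  fix r :: real and f :: "complex ^ 'n \<Rightarrow> complex ^ 'n"
  assume r: "0 < r" and f: "holomorphic_embedding f S (polydisk 1)" "polydisk r \<subseteq> f ` S"
  then have sub: "(polydisk r :: (complex ^ 'n) set) \<subseteq> polydisk 1"
    unfolding holomorphic_embedding_def by blast
  show "r \<le> 1"
  proof (rule ccontr)
    assume "\<not> r \<le> 1"
    then have "(\<chi> i. 1) \<in> (polydisk r :: (complex ^ 'n) set)"
      by (simp add: polydisk_def)
    with sub have "(\<chi> i. 1) \<in> (polydisk 1 :: (complex ^ 'n) set)" by blast
    then show False by (simp add: polydisk_def)
  qed
qed

lemma polydisk_squeezing_nonempty:
  fixes S :: "(complex ^ 'n) set"
  assumes "open S" "bounded S" "z \<in> S"
  shows "{r. 0 < r \<and> (\<exists>f :: complex ^ 'n \<Rightarrow> complex ^ 'n.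
            holomorphic_embedding f S (polydisk 1) \<and> f z = 0 \<and> polydisk r \<subseteq> f ` S)} \<noteq> {}"
proof -
  obtain e where e: "0 < e" "ball z e \<subseteq> S"
    using assms openE by blast
  obtain B where B: "\<And>w. w \<in> S \<Longrightarrow> dist z w \<le> B"
    using assms(2) bounded_any_center[of S z] by blast
  define c where "c = 1 / (\<bar>B\<bar> + 1)"
  have c: "c > 0" "c * \<bar>B\<bar> < 1"
    by (auto simp: c_def field_simps)
  define f where "f = (\<lambda>w :: complex ^ 'n. c *\<^sub>R (w - z))"
  have f_lt: "f w \<in> polydisk 1" if "w \<in> S" for w
    unfolding polydisk_def
  proof (clarify)
    fix i
    have "cmod (f w $ i) \<le> norm (f w)" by (rule Finite_Cartesian_Product.norm_nth_le)
    also have "\<dots> = c * dist z w"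
      using c by (simp add: f_def dist_norm norm_minus_commute)
    also have "\<dots> \<le> c * \<bar>B\<bar>"
      using B[OF that] c by (intro mult_left_mono) auto
    finally show "cmod (f w $ i) < 1" using c by linarith
  qed
  have "holomorphic_map_on f S"
    unfolding holomorphic_map_on_def
  proof
    fix w
    have "(f has_derivative (\<lambda>v. c *\<^sub>R v)) (at w within S)"
      unfolding f_def by (auto intro!: derivative_eq_intros)
    moreover have "\<forall>a v. c *\<^sub>R (a *s v :: complex ^ 'n) = a *s (c *\<^sub>R v)"
      by (simp add: vec_eq_iff)
    ultimately show "\<exists>D. (f has_derivative D) (at w within S) \<and> (\<forall>c v. D (c *s v) = c *s D v)"
      by blast
  qed
  moreover have "inj_on f S"
    using c by (auto simp: inj_on_def f_def)
  ultimately have emb: "holomorphic_embedding f S (polydisk 1)"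
    using f_lt by (auto simp: holomorphic_embedding_def)
  define r where "r = c * e / real CARD('n)"
  have "r > 0" using c e by (simp add: r_def)
  have "polydisk r \<subseteq> f ` S"
  proof
    fix u :: "complex ^ 'n"
    assume u: "u \<in> polydisk r"
    have "norm u \<le> (\<Sum>i\<in>UNIV. cmod (u $ i))" 
      unfolding norm_vec_def by (rule L2_set_le_sum) simp
    also have "\<dots> < (\<Sum>i\<in>(UNIV :: 'n set). r)"
      using u by (intro sum_strict_mono) (auto simp: polydisk_def)
    also have "\<dots> = c * e" by (simp add: r_def)
    finally have "norm (u /\<^sub>R c) < e" using c by (simp add: field_simps)
    then have "z + u /\<^sub>R c \<in> S" using e by (auto simp: dist_norm)
    moreover have "f (z + u /\<^sub>R c) = u" using c by (simp add: f_def)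
    ultimately show "u \<in> f ` S" by (metis image_eqI)
  qed
  moreover have "f z = 0" by (simp add: f_def)
  ultimately show ?thesis
    using emb \<open>r > 0\<close> by blast
qed

definition product_domain :: "complex set \<Rightarrow> complex set \<Rightarrow> (complex ^ 2) set" where
  "product_domain S1 S2 = {z. z $ 1 \<in> S1 \<and> z $ 2 \<in> S2}"

text \<open>The filter of points of \<open>S\<close> whose distance to the boundary of \<open>S\<close> tends to zero. No
  boundary point is singled out. The boundary must be nonempty, since \<open>infdist x {} = 0\<close>; this
  holds for every nonempty bounded open \<open>S\<close>.\<close>

definition to_boundary :: "'a::metric_space set \<Rightarrow> 'a filter" where
  "to_boundary S = inf (filtercomap (\<lambda>x. infdist x (frontier S)) (nhds 0)) (principal S)"

lemma eventually_to_boundary: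
  "eventually P (to_boundary S) \<longleftrightarrow>
     (\<exists>d>0. \<forall>x\<in>S. infdist x (frontier S) < d \<longrightarrow> P x)"
proof
  assume "eventually P (to_boundary S)"
  then obtain Q d where Q: "\<And>y. dist y 0 < d \<Longrightarrow> Q y" "d > 0"
      "\<And>x. Q (infdist x (frontier S)) \<Longrightarrow> x \<in> S \<longrightarrow> P x"
    unfolding to_boundary_def eventually_inf_principal eventually_filtercomap
      eventually_nhds_metric by metis
  have "P x" if "x \<in> S" "infdist x (frontier S) < d" for x
    using Q(1)[of "infdist x (frontier S)"] Q(3) that by (simp add: infdist_nonneg)
  with Q(2) show "\<exists>d>0. \<forall>x\<in>S. infdist x (frontier S) < d \<longrightarrow> P x" by metis
next
  assume "\<exists>d>0. \<forall>x\<in>S. infdist x (frontier S) < d \<longrightarrow> P x"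
  then obtain d where d: "d > 0" "\<And>x. x \<in> S \<Longrightarrow> infdist x (frontier S) < d \<Longrightarrow> P x"
    by metis
  show "eventually P (to_boundary S)"
    unfolding to_boundary_def eventually_inf_principal eventually_filtercomap
    using eventually_nhds_metric[of "\<lambda>y. dist y 0 < d" "0::real"] d
    by (intro exI[of _ "\<lambda>y. dist y 0 < d"]) (auto simp: infdist_nonneg)
qed

end

theory Submission
  imports Defs "HOL-Complex_Analysis.Riemann_Mapping"
begin

text \<open>
  Write \<open>D\<close> for the unit disc. A point \<open>z1\<close> near the boundary of \<open>\<Omega>1\<close> is near some component \<open>A\<close>
  of the complement of \<open>\<Omega>1\<close>. The complement \<open>V\<close> of \<open>A\<close> in the Riemann sphere contains \<open>\<Omega>1\<close> and is
  simply connected. As \<open>A\<close> is not a point, there is a Riemann map \<open>h\<close> of \<open>V\<close> onto \<open>D\<close>. There are only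
  finitely many components, so those other than \<open>A\<close> form a compact subset of \<open>V\<close>. Hence
  \<open>h(\<Omega>1)\<close> is \<open>D\<close> minus a compact set: it contains an annulus \<open>\<rho> < |w| < 1\<close>. Moreover \<open>|h(z1)|\<close> tends
  to \<open>1\<close> as \<open>z1\<close> approaches \<open>A\<close> (\<open>complement_component_annular_embedding\<close>).

  The Moebius transformation of \<open>D\<close> that takes \<open>h(z1)\<close> to \<open>0\<close> pushes the disc \<open>|w| \<le> \<rho>\<close> towards the
  unit circle as \<open>|h(z1)|\<close> tends to \<open>1\<close>. For every \<open>r < 1\<close> the composite therefore
  covers the disc of radius \<open>r\<close> as soon as \<open>z1\<close> is close enough to the boundary
  (\<open>disc_embedding_near_frontier\<close>). Its product with a Riemann map of \<open>\<Omega>2\<close> that vanishes at \<open>z2\<close>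
  embeds \<open>\<Omega>\<close> in the bidisk, with image containing the bidisk of radius \<open>r\<close>, so the squeezing
  function is at least \<open>r\<close>; it is never greater than \<open>1\<close>.
\<close>

section \<open>Complement components in the sphere and in the plane\<close>

lemma closedin_sphere_compact:
  "compact C \<Longrightarrow> closedin riemann_sphere (Some ` C)"
  by (simp add: compact_imp_closed)

lemma closedin_sphere_closed:
  assumes "closed C"
  shows "closedin riemann_sphere (insert None (Some ` C))"
proof -
  have "insert None (Some ` C) = topspace riemann_sphere - Some ` (- C)"
    by (auto simp: image_iff)
  then show ?thesis
    unfolding closedin_Alexandroff_compactification using assms by (metis open_Compl open_openin)
qed

lemma closedin_sphere_vimage:
  assumes "closedin riemann_sphere K"
  shows "closed (Some -` K)"
proof -
  have "closedin euclidean {x \<in> topspace euclidean. Some x \<in> K}"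
    using closedin_continuous_map_preimage[OF continuous_map_Some assms] .
  then show ?thesis by (simp add: vimage_def)
qed

text \<open>
  The finite part of a component \<open>K\<close> of the complement of \<open>\<Omega>\<close> in the sphere is connected even when
  \<open>K\<close> contains infinity: it then contains the connected exterior of a large disc, so in any
  splitting into two closed sets one piece is compact and would also split \<open>K\<close>.
\<close>

lemma connected_sphere_component_vimage:
  assumes \<Omega>: "open \<Omega>" "bounded \<Omega>" and K: "K \<in> sphere_complement_components \<Omega>"
  shows "connected (Some -` K)" "None \<in> K \<longleftrightarrow> \<not> bounded (Some -` K)"
proof -
  define L where "L = topspace riemann_sphere - Some ` \<Omega>"
  have compK: "K \<in> connected_components_of (subtopology riemann_sphere L)"
    using K by (simp add: sphere_complement_components_def L_def)
  have L: "L = insert None (Some ` (- \<Omega>))"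
    by (auto simp: L_def)
  have closL: "closedin riemann_sphere L"
    unfolding L using \<Omega> by (intro closedin_sphere_closed) auto
  have clos: "closedin riemann_sphere C"
    if "C \<in> connected_components_of (subtopology riemann_sphere L)" for C
    using closedin_connected_components_of[OF that] closL closedin_closed_subtopology by blast
  have compactC: "\<exists>B. compact B \<and> C = Some ` B" if "closedin riemann_sphere C" "None \<notin> C" for C
    using that unfolding closedin_Alexandroff_compactification by auto
  have conK: "connectedin riemann_sphere K"
    using connectedin_connected_components_of[OF compK] by (simp add: connectedin_subtopology)
  obtain R where R: "\<Omega> \<subseteq> ball 0 R"
    using \<Omega>(2) bounded_subset_ballD by blast
  \<comment> \<open>a connected neighbourhood of infinity in the plane\<close>
  define N where "N = - ball (0::complex) R"
  have N: "connected N" "\<not> bounded N" "N \<subseteq> - \<Omega>"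
    using R unfolding N_def
    by (auto intro!: connected_complement_bounded_convex cobounded_imp_unbounded)
  have Nsub: "N \<subseteq> Some -` K" if "None \<in> K"
  proof -
    have "connectedin riemann_sphere (Some ` N)"
      by (rule connectedin_continuous_map_image[OF continuous_map_Some]) (simp add: N)
    then have "connectedin (subtopology riemann_sphere L) (Some ` N)"
      using N(3) by (auto simp: connectedin_subtopology L)
    moreover have "subtopology riemann_sphere L \<noteq> trivial_topology"
      by (metis L L_def Diff_subset inf.absorb2 insert_not_empty topspace_subtopology
          null_topspace_iff_trivial)
    ultimately obtain C where C: "C \<in> connected_components_of (subtopology riemann_sphere L)"
        "Some ` N \<subseteq> C"
      using exists_connected_component_of_superset by blast
    have "None \<in> C"
    proof (rule ccontr)
      assume "None \<notin> C"
      then obtain B where "compact B" "C = Some ` B"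
        using compactC clos C(1) by blast
      then have "bounded N"
        using C(2) by (metis bounded_subset compact_imp_bounded inj_Some inj_image_subset_iff)
      with N show False by simp
    qed
    then have "C = K"
      using connected_components_of_overlap[OF C(1) compK] that by blast
    with C show ?thesis by auto
  qed
  show "None \<in> K \<longleftrightarrow> \<not> bounded (Some -` K)"
  proof
    show "\<not> bounded (Some -` K)" if "None \<in> K"
      using Nsub[OF that] N(2) bounded_subset by blast
    show "None \<in> K" if nb: "\<not> bounded (Some -` K)"
    proof (rule ccontr)
      assume "None \<notin> K"
      then obtain B where "compact B" "K = Some ` B"
        using compactC clos compK by blast
      then have "Some -` K = B" by auto
      then show False using nb \<open>compact B\<close> compact_imp_bounded by blast
    qed
  qed
  \<comment> \<open>the finite part of \<open>K\<close> has no splitting into closed sets; \<open>B\<close> is the piece near infinity\<close>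
  have split: False
    if BC: "closed B" "closed C" "B \<noteq> {}" "C \<noteq> {}" "B \<union> C = Some -` K" "B \<inter> C = {}"
      and N_in: "None \<in> K \<Longrightarrow> N \<subseteq> B" for B C
  proof -
    have "bounded C"
    proof (cases "None \<in> K")
      case True
      then have "C \<subseteq> ball 0 R" using N_in BC(6) by (auto simp: N_def)
      then show ?thesis using bounded_ball bounded_subset by blast
    next
      case False
      then obtain D where "compact D" "K = Some ` D"
        using compactC clos compK by blast
      then have "C \<subseteq> D" using BC(5) by auto
      then show ?thesis using \<open>compact D\<close> bounded_subset compact_imp_bounded by blast
    qed
    then have "compact C" using BC compact_eq_bounded_closed by blast
    then have "closedin riemann_sphere (Some ` C)"
      by (rule closedin_sphere_compact)
    moreover have "closedin riemann_sphere (insert None (Some ` B))"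
      using BC by (intro closedin_sphere_closed)
    moreover have "K \<subseteq> insert None (Some ` B) \<union> Some ` C"
    proof
      fix x assume "x \<in> K"
      then show "x \<in> insert None (Some ` B) \<union> Some ` C"
        using BC(5) by (cases x) auto
    qed
    moreover have "insert None (Some ` B) \<inter> Some ` C \<inter> K = {}"
      using BC(6) by auto
    moreover have "insert None (Some ` B) \<inter> K \<noteq> {}" "Some ` C \<inter> K \<noteq> {}"
      using BC by auto
    ultimately show False
      using conK unfolding connectedin_closedin by blast
  qed
  show "connected (Some -` K)"
  proof (rule ccontr)
    assume nc: "\<not> connected (Some -` K)"
    have clK: "closed (Some -` K)"
      using closedin_sphere_vimage[OF clos[OF compK]] .
    from nc obtain B C where BC: "closed B" "closed C" "B \<noteq> {}" "C \<noteq> {}"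
        "B \<union> C = Some -` K" "B \<inter> C = {}"
      unfolding connected_closed_set[OF clK] not_not by (elim exE conjE) (rule that)
    have "(None \<in> K \<longrightarrow> N \<subseteq> B) \<or> (None \<in> K \<longrightarrow> N \<subseteq> C)"
    proof (cases "None \<in> K")
      case True
      then have "N \<subseteq> B \<union> C" "B \<inter> C \<inter> N = {}" using Nsub BC by auto
      then have "B \<inter> N = {} \<or> C \<inter> N = {}"
        using N(1) BC(1,2) unfolding connected_closed by blast
      then show ?thesis using \<open>N \<subseteq> B \<union> C\<close> by blast
    qed simp
    then show False
    proof
      assume "None \<in> K \<longrightarrow> N \<subseteq> B"
      then show False using split[OF BC] by simp
    next
      assume "None \<in> K \<longrightarrow> N \<subseteq> C"
      then show False
        using split[OF BC(2,1,4,3)] BC(5,6) by (simp add: Int_commute Un_commute)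
    qed
  qed
qed

text \<open>
  The plane sits continuously in the sphere, so \<open>A\<close> lies in a component \<open>K\<close> of the complement
  there; as the finite part of \<open>K\<close> is connected, the maximality of \<open>A\<close> gives equality.
\<close>

lemma complement_component_eq_vimage:
  assumes \<Omega>: "open \<Omega>" "bounded \<Omega>" and A: "A \<in> components (- \<Omega>)"
  obtains K where "K \<in> sphere_complement_components \<Omega>" "A = Some -` K"
proof -
  define L where "L = topspace riemann_sphere - Some ` \<Omega>"
  have L: "L = insert None (Some ` (- \<Omega>))"
    by (auto simp: L_def)
  obtain x where x: "x \<in> A" using in_components_nonempty[OF A] by auto
  have "connectedin riemann_sphere (Some ` A)"
    by (rule connectedin_continuous_map_image[OF continuous_map_Some])
      (simp add: in_components_connected[OF A])
  then have conA: "connectedin (subtopology riemann_sphere L) (Some ` A)"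
    using in_components_subset[OF A] by (auto simp: connectedin_subtopology L)
  moreover have "subtopology riemann_sphere L \<noteq> trivial_topology"
    by (metis L L_def Diff_subset inf.absorb2 insert_not_empty topspace_subtopology
        null_topspace_iff_trivial)
  ultimately obtain K where K: "K \<in> connected_components_of (subtopology riemann_sphere L)"
      "Some ` A \<subseteq> K"
    using exists_connected_component_of_superset by blast
  have K': "K \<in> sphere_complement_components \<Omega>"
    using K by (simp add: sphere_complement_components_def L_def)
  have "K \<subseteq> L"
    using connected_components_of_subset[OF K(1)] by auto
  then have "Some -` K \<subseteq> - \<Omega>" by (auto simp: L)
  moreover have "A \<inter> Some -` K \<noteq> {}" using K(2) x by auto
  ultimately have "Some -` K \<subseteq> A"
    using components_maximal[OF A connected_sphere_component_vimage(1)[OF \<Omega> K']] by blast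
  then have "A = Some -` K" using K(2) by auto
  with K' show ?thesis by (rule that)
qed

lemma finite_complement_components:
  assumes "open \<Omega>" "bounded \<Omega>" "finite (sphere_complement_components \<Omega>)"
  shows "finite (components (- \<Omega>))"
proof (rule finite_subset)
  show "components (- \<Omega>) \<subseteq> (\<lambda>K. Some -` K) ` sphere_complement_components \<Omega>"
    using complement_component_eq_vimage[OF assms(1,2)] by blast
qed (use assms in simp)

lemma complement_component_not_singleton:
  assumes \<Omega>: "open \<Omega>" "bounded \<Omega>"
    and ns: "\<forall>C\<in>sphere_complement_components \<Omega>. \<not> is_singleton C"
    and A: "A \<in> components (- \<Omega>)"
  shows "\<not> is_singleton A"
proof
  assume "is_singleton A"
  then obtain x where x: "A = {x}" by (auto simp: is_singleton_def)
  obtain K where K: "K \<in> sphere_complement_components \<Omega>" "A = Some -` K"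
    using complement_component_eq_vimage[OF \<Omega> A] .
  have "None \<notin> K"
    using connected_sphere_component_vimage(2)[OF \<Omega> K(1)] K(2)[symmetric] x by auto
  have "y = Some x" if "y \<in> K" for y
  proof (cases y)
    case (Some z)
    then have "z \<in> A" using K that by auto
    then show ?thesis using x Some by auto
  qed (use \<open>None \<notin> K\<close> that in auto)
  moreover have "Some x \<in> K" using K x by auto
  ultimately have "K = {Some x}" by blast
  then show False using ns K by auto
qed

section \<open>Simple connectedness of the complement of a component\<close>

text \<open>
  The set \<open>V\<close> is the image of the complement of \<open>A\<close> in the sphere under the inversion
  \<open>z \<mapsto> 1 / (z - p)\<close>; the point \<open>0\<close> corresponds to infinity. It is simply connected because the
  winding number of a loop in \<open>V\<close> about \<open>1 / (b - p)\<close> is locally constant in \<open>b\<close> on the connected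
  set \<open>A\<close>, and it vanishes for \<open>b\<close> near \<open>p\<close>.
\<close>

lemma simply_connected_inverted_complement:
  fixes A :: "complex set" and p :: complex
  assumes A: "compact A" "connected A" "connected (- A)" and p: "p \<in> A"
  defines "V \<equiv> {w. w = 0 \<or> p + 1 / w \<notin> A}"
  shows "open V" "simply_connected V"
proof -
  have p_inv: "p + 1 / (1 / (z - p)) = z" for z by simp
  obtain R where R: "R > 0" "A \<subseteq> ball p R"
    using A(1) by (metis compact_imp_bounded bounded_subset_ballD)
  have small: "w \<in> V" if "norm w < 1 / R" for w
  proof (cases "w = 0")
    case False
    then have "norm (1 / w) > R" using that R by (simp add: norm_divide field_simps)
    then show ?thesis using R(2) by (auto simp: V_def dist_norm)
  qed (simp add: V_def)
  have "continuous_on (- {0}) (\<lambda>w. p + 1 / w)"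
    by (intro continuous_intros) auto
  then have "open ((- {0}) \<inter> (\<lambda>w. p + 1 / w) -` (- A))"
    using A(1) by (intro continuous_open_preimage) (auto simp: compact_imp_closed)
  moreover have "ball 0 (1 / R) \<subseteq> V" "0 \<in> ball 0 (1 / R)"
    using small R by auto
  then have "V = ((- {0}) \<inter> (\<lambda>w. p + 1 / w) -` (- A)) \<union> ball 0 (1 / R)"
    unfolding V_def by blast
  ultimately show opV: "open V" by (metis open_Un open_ball)
  define J where "J = (\<lambda>z. 1 / (z - p))"
  have contJ: "continuous_on (- {p}) J"
    unfolding J_def by (intro continuous_intros) auto
  have JA: "J ` (- A) \<subseteq> V" by (auto simp: J_def V_def)
  have VJA: "w \<in> J ` (- A)" if "w \<in> V" "w \<noteq> 0" for w
    using that by (intro image_eqI[of _ _ "p + 1 / w"]) (auto simp: J_def V_def)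
  have "connected (J ` (- A))"
    using contJ p A(3) by (intro connected_continuous_image) (auto intro: continuous_on_subset)
  moreover have "0 \<in> closure (J ` (- A))"
    unfolding closure_approachable
  proof (intro allI impI)
    fix e :: real assume "e > 0"
    obtain d where d: "d > 0" "d < e" "d < 1 / R"
      using \<open>e > 0\<close> R field_lbound_gt_zero[of e "1 / R"] by auto
    have "complex_of_real d \<in> J ` (- A)"
      using d by (intro VJA small) auto
    then show "\<exists>y\<in>J ` (- A). dist y 0 < e" using d(1,2) by (intro bexI) auto
  qed
  ultimately have conV: "connected V"
    using connected_intermediate_closure[of "J ` (- A)" V] JA VJA closure_subset[of "J ` (- A)"]
    by blast
  show "simply_connected V"
    unfolding simply_connected_eq_winding_number_zero[OF opV]
  proof (intro conjI conV allI impI, elim conjE)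
    fix g z
    assume g: "path g" "path_image g \<subseteq> V" "pathfinish g = pathstart g" "z \<notin> V"
    obtain B where B: "\<And>z. B \<le> norm z \<Longrightarrow> winding_number g z = 0"
      using winding_number_zero_at_infinity[OF g(1,3)] by blast
    define e where "e = 1 / (\<bar>B\<bar> + 1)"
    have e: "e > 0" by (simp add: e_def)
    have near: "winding_number g (J b) = 0" if "b \<in> ball p e" "b \<noteq> p" for b
    proof (rule B)
      have "norm (b - p) > 0" "norm (b - p) < 1 / (\<bar>B\<bar> + 1)"
        using that by (auto simp: dist_norm e_def norm_minus_commute)
      then have "\<bar>B\<bar> + 1 < 1 / norm (b - p)"
        by (simp add: field_simps)
      then show "B \<le> norm (J b)" by (simp add: J_def norm_divide)
    qed
    \<comment> \<open>on \<open>A\<close>, \<open>E1\<close> is \<open>p\<close> with the points of winding number zero, and \<open>E2\<close> is the rest\<close>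
    define W where "W = (\<lambda>k. {z. z \<notin> path_image g \<and> winding_number g z = k})"
    have opW: "open (- {p} \<inter> J -` (\<Union>k\<in>S. W k))" for S
      using contJ open_winding_number_levelsets[OF g(1,3)]
      by (intro continuous_open_preimage) (auto simp: W_def)
    define E1 where "E1 = ball p e \<union> (- {p} \<inter> J -` (\<Union>k\<in>{0}. W k))"
    define E2 where "E2 = (- {p} \<inter> J -` (\<Union>k\<in>- {0}. W k))"
    have "open E1" "open E2"
      using opW[of "{0}"] opW[of "- {0}"] unfolding E1_def E2_def by (blast intro: open_Un open_ball)+
    have off: "J b \<notin> path_image g" if "b \<in> A" "b \<noteq> p" for b
      using that g(2) by (auto simp: V_def J_def)
    have "A \<subseteq> E1 \<union> E2"
    proof
      fix b assume "b \<in> A"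
      then show "b \<in> E1 \<union> E2"
        using off[of b] e by (cases "b = p") (auto simp: E1_def E2_def W_def)
    qed
    moreover have E12: "E1 \<inter> E2 \<inter> A = {}"
      using near by (auto simp: E1_def E2_def W_def)
    moreover have "p \<in> E1 \<inter> A" using p e by (auto simp: E1_def)
    ultimately have disj: "E2 \<inter> A = {}"
      using connectedD[OF A(2) \<open>open E1\<close> \<open>open E2\<close>] by blast
    have z: "z \<noteq> 0" "p + 1 / z \<in> A" using g(4) by (auto simp: V_def)
    then have "p + 1 / z \<in> E1" using disj \<open>A \<subseteq> E1 \<union> E2\<close> by blast
    then have "winding_number g (J (p + 1 / z)) = 0"
      using near z by (auto simp: E1_def W_def)
    then show "winding_number g z = 0" using z by (simp add: J_def)
  qed
qed

section \<open>Riemann maps of complements of components\<close>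

text \<open>
  The map \<open>J\<close> is a coordinate change that places \<open>\<Omega>\<close> in a simply connected plane domain \<open>V\<close>. The
  hypothesis \<open>far\<close> says that \<open>J z\<close> leaves every compact subset of \<open>V\<close> as \<open>z\<close> approaches \<open>A\<close>.
\<close>

lemma annular_embedding:
  assumes V: "open V" "simply_connected V" "V \<noteq> UNIV" "V \<noteq> {}"
    and J: "J holomorphic_on \<Omega>" "inj_on J \<Omega>" "J ` \<Omega> \<subseteq> V" and cpt: "compact (V - J ` \<Omega>)"
    and far: "\<And>G. compact G \<Longrightarrow> G \<subseteq> V \<Longrightarrow> \<exists>d>0. \<forall>z\<in>\<Omega>. \<forall>a\<in>A. dist z a < d \<longrightarrow> J z \<notin> G"
  obtains h \<rho> where "h holomorphic_on \<Omega>" "inj_on h \<Omega>" "h ` \<Omega> \<subseteq> ball 0 1"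
    "0 \<le> \<rho>" "\<rho> < 1" "ball 0 1 - cball 0 \<rho> \<subseteq> h ` \<Omega>"
    "\<And>s. s < 1 \<Longrightarrow> \<exists>d>0. \<forall>z\<in>\<Omega>. \<forall>a\<in>A. dist z a < d \<longrightarrow> s < norm (h z)"
proof -
  obtain f g where fg: "f holomorphic_on V" "g holomorphic_on ball 0 1"
      "\<And>z. z \<in> V \<Longrightarrow> f z \<in> ball 0 1 \<and> g (f z) = z"
      "\<And>w. w \<in> ball 0 1 \<Longrightarrow> g w \<in> V \<and> f (g w) = w"
    using V simply_connected_eq_biholomorphic_to_disc[OF V(1)] by metis
  have contf: "continuous_on V f" and contg: "continuous_on (ball 0 1) g"
    using fg holomorphic_on_imp_continuous_on by auto
  have "compact (f ` (V - J ` \<Omega>))"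
    using continuous_on_subset[OF contf] cpt by (intro compact_continuous_image) auto
  then have cn: "compact (norm ` f ` (V - J ` \<Omega>))"
    by (rule compact_continuous_image[rotated]) (intro continuous_intros)
  obtain \<rho> where \<rho>: "0 \<le> \<rho>" "\<rho> < 1" "\<And>z. z \<in> V - J ` \<Omega> \<Longrightarrow> norm (f z) \<le> \<rho>"
  proof (cases "V - J ` \<Omega> = {}")
    case False
    then obtain y where y: "y \<in> norm ` f ` (V - J ` \<Omega>)"
        "\<And>x. x \<in> norm ` f ` (V - J ` \<Omega>) \<Longrightarrow> x \<le> y"
      using compact_attains_sup[OF cn] by auto
    then have "0 \<le> y" "y < 1" using fg(3) by auto
    with y that show ?thesis by blast
  qed (use that[of 0] in auto)
  show ?thesis
  proof
    show "(\<lambda>z. f (J z)) holomorphic_on \<Omega>"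
      using holomorphic_on_compose_gen[OF J(1) fg(1)] J(3) by (auto simp: o_def)
    show "inj_on (\<lambda>z. f (J z)) \<Omega>"
      using J(2,3) fg(3) by (auto simp: inj_on_def image_subset_iff) metis
    show "(\<lambda>z. f (J z)) ` \<Omega> \<subseteq> ball 0 1"
      using fg(3) J(3) by blast
    show "0 \<le> \<rho>" "\<rho> < 1" by fact+
    show "ball 0 1 - cball 0 \<rho> \<subseteq> (\<lambda>z. f (J z)) ` \<Omega>"
    proof
      fix w assume w: "w \<in> ball 0 1 - cball (0::complex) \<rho>"
      then have g: "g w \<in> V" "f (g w) = w" using fg(4) by auto
      then have "g w \<in> J ` \<Omega>" using \<rho>(3)[of "g w"] w by auto
      with g show "w \<in> (\<lambda>z. f (J z)) ` \<Omega>" by auto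
    qed
    fix s :: real assume "s < 1"
    then have sub: "cball 0 s \<subseteq> ball (0::complex) 1" by auto
    then have "compact (g ` cball 0 s)"
      using continuous_on_subset[OF contg sub] by (intro compact_continuous_image) auto
    moreover have "g ` cball 0 s \<subseteq> V" using fg(4) sub by blast
    ultimately obtain d where d: "d > 0" "\<forall>z\<in>\<Omega>. \<forall>a\<in>A. dist z a < d \<longrightarrow> J z \<notin> g ` cball 0 s"
      using far by blast
    have "s < norm (f (J z))" if "z \<in> \<Omega>" "a \<in> A" "dist z a < d" for z a
    proof (rule ccontr)
      assume "\<not> s < norm (f (J z))"
      then have "J z \<in> g ` cball 0 s"
        using fg(3)[of "J z"] J(3) that by (intro image_eqI[of _ _ "f (J z)"]) auto
      with d that show False by blast
    qed
    with d(1) show "\<exists>d>0. \<forall>z\<in>\<Omega>. \<forall>a\<in>A. dist z a < d \<longrightarrow> s < norm (f (J z))" by blast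
  qed
qed

text \<open>
  For an unbounded component \<open>A\<close> the plane domain \<open>- A\<close> is used directly. For a bounded one, the
  complement of \<open>A\<close> in the sphere contains infinity and is first moved into the plane by inversion
  at a point \<open>p\<close> of \<open>A\<close>; a second point \<open>q\<close> of \<open>A\<close> shows that the result is not the whole plane.
\<close>

lemma complement_component_annular_embedding:
  assumes \<Omega>: "open \<Omega>" "connected \<Omega>" "bounded \<Omega>" "\<Omega> \<noteq> {}"
    and fin: "finite (components (- \<Omega>))"
    and A: "A \<in> components (- \<Omega>)" "\<not> is_singleton A"
  obtains h \<rho> where "h holomorphic_on \<Omega>" "inj_on h \<Omega>" "h ` \<Omega> \<subseteq> ball 0 1"
    "0 \<le> \<rho>" "\<rho> < 1" "ball 0 1 - cball 0 \<rho> \<subseteq> h ` \<Omega>"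
    "\<And>s. s < 1 \<Longrightarrow> \<exists>d>0. \<forall>z\<in>\<Omega>. \<forall>a\<in>A. dist z a < d \<longrightarrow> s < norm (h z)"
proof -
  have clA: "closed A" and conA: "connected A" and neA: "A \<noteq> {}" and subA: "A \<subseteq> - \<Omega>"
    using closed_components[OF _ A(1)] \<Omega>(1) in_components_connected[OF A(1)]
      in_components_nonempty[OF A(1)] in_components_subset[OF A(1)] by auto
  have conA': "connected (- A)"
    using component_complement_connected[OF \<Omega>(2) A(1)] .
  define B where "B = \<Union>(components (- \<Omega>) - {A})"
  have clB: "closed B"
    unfolding B_def using fin \<Omega>(1) closed_components[of "- \<Omega>"] by (intro closed_Union) auto
  have AB: "A \<union> B = - \<Omega>"
  proof -
    have "A \<union> B = \<Union>(components (- \<Omega>))" unfolding B_def using A(1) by blast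
    then show ?thesis using Union_components[of "- \<Omega>"] by simp
  qed
  have disj: "A \<inter> B = {}"
    using components_nonoverlap[OF A(1)] by (fastforce simp: B_def)
  show ?thesis
  proof (cases "bounded A")
    case False
    have opV: "open (- A)" using clA by auto
    have "components A = {A}" using conA neA by (simp add: components_eq_sing_iff)
    then have V: "simply_connected (- A)" "- A \<noteq> UNIV" "- A \<noteq> {}"
      using simply_connected_eq_unbounded_complement_components[OF opV] conA' False neA subA \<Omega>(4)
      by auto
    obtain R where R: "\<Omega> \<subseteq> ball 0 R"
      using \<Omega>(3) bounded_subset_ballD by blast
    have "connected (- ball (0::complex) R)"
      by (intro connected_complement_bounded_convex) auto
    moreover have "A \<inter> - ball 0 R \<noteq> {}"
      using False bounded_subset[OF bounded_ball] by blast
    ultimately have "- ball 0 R \<subseteq> A"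
      using components_maximal[OF A(1)] R by blast
    then have "- A - (\<lambda>z. z) ` \<Omega> \<subseteq> ball 0 R" by auto
    moreover have "- A - (\<lambda>z. z) ` \<Omega> = B" using AB disj by auto
    ultimately have cpt: "compact (- A - (\<lambda>z. z) ` \<Omega>)"
      using clB bounded_subset[OF bounded_ball] compact_eq_bounded_closed by metis
    have far: "\<exists>d>0. \<forall>z\<in>\<Omega>. \<forall>a\<in>A. dist z a < d \<longrightarrow> z \<notin> G" if G: "compact G" "G \<subseteq> - A" for G
    proof -
      have "G \<inter> A = {}" using G(2) by blast
      then obtain d where "d > 0" "\<forall>x\<in>G. \<forall>y\<in>A. d \<le> dist x y"
        using separate_compact_closed[OF G(1) clA] by blast
      then show ?thesis by (intro exI[of _ d]) force
    qed
    show ?thesis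
      by (rule annular_embedding[OF opV V _ _ _ cpt far]) (use subA that in auto)
  next
    case True
    then have cptA: "compact A" using clA compact_eq_bounded_closed by blast
    obtain p where p: "p \<in> A" using neA by blast
    obtain q where q: "q \<in> A" "q \<noteq> p" using A(2) p unfolding is_singleton_def by blast
    define J where "J = (\<lambda>z. 1 / (z - p))"
    define V where "V = {w. w = 0 \<or> p + 1 / w \<notin> A}"
    have V: "open V" "simply_connected V"
      using simply_connected_inverted_complement[OF cptA conA conA' p] by (auto simp: V_def)
    have V': "V \<noteq> UNIV" "V \<noteq> {}"
    proof -
      have "1 / (q - p) \<notin> V" using q by (auto simp: V_def)
      then show "V \<noteq> UNIV" by blast
      show "V \<noteq> {}" by (auto simp: V_def)
    qed
    have pO: "p \<notin> \<Omega>" using p subA by blast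
    have J: "J holomorphic_on \<Omega>" "inj_on J \<Omega>" "J ` \<Omega> \<subseteq> V"
      using pO subA unfolding J_def V_def
      by (auto intro!: holomorphic_intros simp: inj_on_def)
    \<comment> \<open>the other components, together with infinity, seen in the inverted coordinate\<close>
    have VJ: "V - J ` \<Omega> = {w. w = 0 \<or> p + 1 / w \<in> B}" (is "_ = ?Q")
    proof (intro equalityI subsetI)
      fix w assume w: "w \<in> V - J ` \<Omega>"
      then have "p + 1 / w \<notin> \<Omega>" if "w \<noteq> 0"
        using w by (force simp: J_def intro: rev_image_eqI)
      then show "w \<in> ?Q" using w AB by (auto simp: V_def)
    next
      fix w assume w: "w \<in> ?Q"
      have "w \<noteq> J z" if z: "z \<in> \<Omega>" for z
      proof
        assume "w = J z"
        moreover have "z \<noteq> p" using z pO by blast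
        ultimately have "w \<noteq> 0" "p + 1 / w = z" by (auto simp: J_def)
        then have "z \<in> B" using w by simp
        then show False using z AB by blast
      qed
      moreover have "w \<in> V" using w disj by (auto simp: V_def)
      ultimately show "w \<in> V - J ` \<Omega>" by blast
    qed
    have "p \<notin> B" using p disj by auto
    then obtain e where e: "e > 0" "ball p e \<inter> B = {}"
      using clB by (metis Compl_iff disjoint_eq_subset_Compl open_Compl openE)
    have bd: "norm w \<le> 1 / e" if "w \<in> ?Q" for w
    proof (cases "w = 0")
      case False
      then have "p + 1 / w \<notin> ball p e" using that e(2) by blast
      then have "e \<le> norm (1 / w)" by (simp add: dist_norm)
      then show ?thesis using e False by (simp add: norm_divide field_simps)
    qed (use e in simp)
    have "closed ?Q"
      unfolding closed_sequential_limits
    proof (intro allI impI, elim conjE)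
      fix x l assume x: "\<forall>n. x n \<in> ?Q" "x \<longlonglongrightarrow> l"
      show "l \<in> ?Q"
      proof (cases "l = 0")
        case False
        then have "eventually (\<lambda>n. x n \<noteq> 0) sequentially"
          using tendsto_imp_eventually_ne[OF x(2)] by blast
        then have "eventually (\<lambda>n. p + 1 / x n \<in> B) sequentially"
          by eventually_elim (use x(1) in auto)
        moreover have "(\<lambda>n. p + 1 / x n) \<longlonglongrightarrow> p + 1 / l"
          using x(2) False by (intro tendsto_intros)
        ultimately have "p + 1 / l \<in> B"
          by (intro Lim_in_closed_set[OF clB, of _ sequentially]) auto
        then show ?thesis by simp
      qed simp
    qed
    then have cpt: "compact (V - J ` \<Omega>)"
      unfolding VJ compact_eq_bounded_closed bounded_iff using bd by blast
    have far: "\<exists>d>0. \<forall>z\<in>\<Omega>. \<forall>a\<in>A. dist z a < d \<longrightarrow> J z \<notin> G" if G: "compact G" "G \<subseteq> V" for G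
    proof -
      obtain M where M: "M > 0" "\<And>w. w \<in> G \<Longrightarrow> norm w \<le> M"
        using compact_imp_bounded[OF G(1)] bounded_pos by blast
      \<comment> \<open>the preimage of \<open>G\<close> is closed: it keeps away from the pole \<open>p\<close>, as \<open>G\<close> is bounded\<close>
      define S where "S = - ball p (1 / M) \<inter> J -` G"
      have "continuous_on (- ball p (1 / M)) J"
        unfolding J_def using M(1) by (intro continuous_intros) auto
      then have "closed S"
        unfolding S_def using G(1) by (intro continuous_closed_preimage) (auto simp: compact_imp_closed)
      moreover have "A \<inter> S = {}"
      proof -
        have "a \<noteq> p \<and> J a \<in> V" if "a \<in> S" for a
          using that G M(1) by (auto simp: S_def)
        then show ?thesis by (auto simp: J_def V_def)
      qed
      ultimately obtain d where d: "d > 0" "\<forall>x\<in>A. \<forall>y\<in>S. d \<le> dist x y"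
        using separate_compact_closed[OF cptA] by blast
      have "J z \<notin> G" if z: "z \<in> \<Omega>" "a \<in> A" "dist z a < d" for z a
      proof
        assume "J z \<in> G"
        moreover have "norm (z - p) > 0" using z(1) pO by auto
        ultimately have "1 / M \<le> norm (z - p)"
          using M(2)[of "J z"] M(1) by (simp add: J_def norm_divide field_simps)
        then have "z \<in> S" using \<open>J z \<in> G\<close> by (auto simp: S_def dist_norm norm_minus_commute)
        then show False using d(2) z by (metis dist_commute not_less)
      qed
      with d(1) show ?thesis by blast
    qed
    show ?thesis
      by (rule annular_embedding[OF V V' J cpt far]) (use that in auto)
  qed
qed

section \<open>Embeddings in the disc covering a large concentric disc\<close>

text \<open>
  With \<open>u\<close> the value of the Moebius function, the reason is the identity
  \<open>(1 - |u|\<^sup>2) |1 + cnj a w|\<^sup>2 = (1 - |a|\<^sup>2) (1 - |w|\<^sup>2)\<close> together with \<open>|1 + cnj a w| \<ge> 1 - r\<close>.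
\<close>

lemma Moebius_function_norm_gt:
  assumes a: "norm a < 1" and w: "norm w < r" "r < 1" and \<rho>: "0 \<le> \<rho>" "\<rho> < 1"
    and close: "1 - (norm a)\<^sup>2 < (1 - \<rho>\<^sup>2) * (1 - r)\<^sup>2"
  shows "\<rho> < norm (Moebius_function 0 (- a) w)"
proof -
  define D where "D = norm (1 + cnj a * w)"
  have "norm a * norm w \<le> 1 * r"
    using a w by (intro mult_mono) auto
  then have "1 - r \<le> 1 - norm (cnj a * w)" by (simp add: norm_mult)
  also have "\<dots> \<le> D"
    unfolding D_def using norm_diff_ineq[of 1 "cnj a * w"] by simp
  finally have D: "1 - r \<le> D" .
  then have D0: "D > 0" using w(2) by linarith
  have "D\<^sup>2 - (norm (w + a))\<^sup>2 = (1 - (norm a)\<^sup>2) * (1 - (norm w)\<^sup>2)"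
    unfolding D_def cmod_power2 by (simp add: algebra_simps power2_eq_square)
  also have "\<dots> \<le> (1 - (norm a)\<^sup>2) * 1"
    using a by (intro mult_left_mono) (auto simp: power_le_one)
  also have "\<dots> < (1 - \<rho>\<^sup>2) * D\<^sup>2"
  proof -
    have "(1 - \<rho>\<^sup>2) * (1 - r)\<^sup>2 \<le> (1 - \<rho>\<^sup>2) * D\<^sup>2"
      using D w(2) \<rho> by (intro mult_left_mono power_mono) (auto simp: power_le_one)
    then show ?thesis using close by simp
  qed
  finally have "(\<rho> * D)\<^sup>2 < (norm (w + a))\<^sup>2"
    by (simp add: algebra_simps power_mult_distrib)
  then have "\<rho> * D < norm (w + a)"
    by (rule power2_less_imp_less) simp
  then show ?thesis
    using D0 by (simp add: Moebius_function_simple norm_divide D_def field_simps)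
qed

lemma disc_embedding_near_component:
  assumes \<Omega>: "open \<Omega>" "connected \<Omega>" "bounded \<Omega>" "\<Omega> \<noteq> {}"
    and fin: "finite (components (- \<Omega>))"
    and A: "A \<in> components (- \<Omega>)" "\<not> is_singleton A"
    and r: "r < 1"
  shows "\<exists>d>0. \<forall>z\<in>\<Omega>. \<forall>a\<in>A. dist z a < d \<longrightarrow>
    (\<exists>h. h holomorphic_on \<Omega> \<and> inj_on h \<Omega> \<and> h ` \<Omega> \<subseteq> ball 0 1 \<and> h z = 0 \<and> ball 0 r \<subseteq> h ` \<Omega>)"
proof -
  obtain h \<rho> where h: "h holomorphic_on \<Omega>" "inj_on h \<Omega>" "h ` \<Omega> \<subseteq> ball 0 1"
    and \<rho>: "0 \<le> \<rho>" "\<rho> < 1" "ball 0 1 - cball 0 \<rho> \<subseteq> h ` \<Omega>"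
    and near: "\<And>s. s < 1 \<Longrightarrow> \<exists>d>0. \<forall>z\<in>\<Omega>. \<forall>a\<in>A. dist z a < d \<longrightarrow> s < norm (h z)"
    using complement_component_annular_embedding[OF \<Omega> fin A] by metis
  define c where "c = (1 - \<rho>\<^sup>2) * (1 - r)\<^sup>2"
  have "\<rho>\<^sup>2 < 1" using \<rho> by (simp add: abs_square_less_1)
  then have c: "c > 0" using r by (simp add: c_def)
  \<comment> \<open>\<open>s < |b|\<close> will give \<open>1 - |b|\<^sup>2 < c\<close>, which \<open>Moebius_function_norm_gt\<close> needs\<close>
  define s where "s = sqrt (max 0 (1 - c))"
  have "s < 1" using c by (simp add: s_def)
  then obtain d where d: "d > 0" "\<And>z a. z \<in> \<Omega> \<Longrightarrow> a \<in> A \<Longrightarrow> dist z a < d \<Longrightarrow> s < norm (h z)"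
    using near by blast
  have "\<exists>h. h holomorphic_on \<Omega> \<and> inj_on h \<Omega> \<and> h ` \<Omega> \<subseteq> ball 0 1 \<and> h z = 0 \<and> ball 0 r \<subseteq> h ` \<Omega>"
    if z: "z \<in> \<Omega>" "a \<in> A" "dist z a < d" for z a
  proof -
    define b where "b = h z"
    have b: "norm b < 1" using h(3) z(1) by (auto simp: b_def)
    have "s\<^sup>2 < (norm b)\<^sup>2"
      unfolding b_def using d(2)[OF z] by (intro power_strict_mono) (auto simp: s_def)
    then have close: "1 - (norm b)\<^sup>2 < c" by (simp add: s_def)
    define M where "M = Moebius_function 0 b"
    have Minv: "M (Moebius_function 0 (- b) w) = w" if "norm w < 1" for w
      unfolding M_def using b that by (intro Moebius_function_compose) auto
    have Minv': "Moebius_function 0 (- b) (M w) = w" if "norm w < 1" for w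
      unfolding M_def using b that by (intro Moebius_function_compose) auto
    have holM: "M holomorphic_on ball 0 1"
      unfolding M_def using b by (intro Moebius_function_holomorphic)
    show ?thesis
    proof (intro exI[of _ "\<lambda>z. M (h z)"] conjI)
      show "(\<lambda>z. M (h z)) holomorphic_on \<Omega>"
        using holomorphic_on_compose_gen[OF h(1) holM h(3)] by (simp add: o_def)
      have h1: "norm (h x) < 1" if "x \<in> \<Omega>" for x using h(3) that by auto
      show "inj_on (\<lambda>z. M (h z)) \<Omega>"
        using h(2) h1 Minv' by (auto simp: inj_on_def) metis
      show "(\<lambda>z. M (h z)) ` \<Omega> \<subseteq> ball 0 1"
        using h1 b by (auto simp: M_def Moebius_function_norm_lt_1)
      show "M (h z) = 0" by (simp add: M_def b_def Moebius_function_eq_zero)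
      show "ball 0 r \<subseteq> (\<lambda>z. M (h z)) ` \<Omega>"
      proof
        fix w assume "w \<in> ball (0::complex) r"
        then have w: "norm w < r" "norm w < 1" using r by auto
        define u where "u = Moebius_function 0 (- b) w"
        have "\<rho> < norm u"
          unfolding u_def by (rule Moebius_function_norm_gt[OF b w(1) r \<rho>(1,2)])
            (use close c_def in simp)
        moreover have "norm u < 1"
          unfolding u_def using b w by (intro Moebius_function_norm_lt_1) auto
        ultimately obtain x where "x \<in> \<Omega>" "h x = u" using \<rho>(3) by force
        moreover have "M u = w" unfolding u_def using Minv w by simp
        ultimately show "w \<in> (\<lambda>z. M (h z)) ` \<Omega>" by auto
      qed
    qed
  qed
  with d(1) show ?thesis by blast
qed

lemma disc_embedding_near_frontier:
  assumes \<Omega>: "open \<Omega>" "connected \<Omega>" "bounded \<Omega>" "\<Omega> \<noteq> {}"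
    and fin: "finite (components (- \<Omega>))"
    and ns: "\<And>A. A \<in> components (- \<Omega>) \<Longrightarrow> \<not> is_singleton A"
    and r: "r < 1"
  shows "\<exists>d>0. \<forall>z\<in>\<Omega>. infdist z (frontier \<Omega>) < d \<longrightarrow>
    (\<exists>h. h holomorphic_on \<Omega> \<and> inj_on h \<Omega> \<and> h ` \<Omega> \<subseteq> ball 0 1 \<and> h z = 0 \<and> ball 0 r \<subseteq> h ` \<Omega>)"
proof -
  define good where "good z \<longleftrightarrow> (\<exists>h. h holomorphic_on \<Omega> \<and> inj_on h \<Omega> \<and> h ` \<Omega> \<subseteq> ball 0 1 \<and>
      h z = 0 \<and> ball 0 r \<subseteq> h ` \<Omega>)" for z
  let ?C = "components (- \<Omega>)"
  have "\<forall>A\<in>?C. \<exists>d>0. \<forall>z\<in>\<Omega>. \<forall>a\<in>A. dist z a < d \<longrightarrow> good z"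
    unfolding good_def using disc_embedding_near_component[OF \<Omega> fin _ ns r] by blast
  then obtain d where d: "\<And>A. A \<in> ?C \<Longrightarrow> d A > 0"
      "\<And>A z a. A \<in> ?C \<Longrightarrow> z \<in> \<Omega> \<Longrightarrow> a \<in> A \<Longrightarrow> dist z a < d A \<Longrightarrow> good z"
    by (metis (no_types, lifting))
  have "\<Omega> \<noteq> UNIV" using \<Omega>(3) not_bounded_UNIV by blast
  then have "- \<Omega> \<noteq> {}" by blast
  then have "?C \<noteq> {}" by simp
  then have ex: "Min (d ` ?C) > 0" using fin d(1) by auto
  have "good z" if z: "z \<in> \<Omega>" "infdist z (frontier \<Omega>) < Min (d ` ?C)" for z
  proof -
    have "frontier \<Omega> \<noteq> {}" using \<Omega>(4) \<open>\<Omega> \<noteq> UNIV\<close> frontier_eq_empty by blast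
    then obtain x where x: "x \<in> frontier \<Omega>" "infdist z (frontier \<Omega>) = dist z x"
      using infdist_attains_inf[OF frontier_closed] by blast
    have "x \<in> - \<Omega>" using x(1) \<Omega>(1) by (simp add: frontier_def interior_open)
    then obtain A where A: "A \<in> ?C" "x \<in> A" using Union_components[of "- \<Omega>"] by blast
    have "Min (d ` ?C) \<le> d A" using fin A by simp
    then show ?thesis using d(2)[OF A(1) z(1) A(2)] x z by simp
  qed
  with ex show ?thesis unfolding good_def by blast
qed

lemma simply_connected_disc_embedding:
  assumes "open \<Omega>" "bounded \<Omega>" "simply_connected \<Omega>" "z \<in> \<Omega>"
  obtains h where "h holomorphic_on \<Omega>" "inj_on h \<Omega>" "h ` \<Omega> = ball 0 1" "h z = 0"
proof -
  have "\<Omega> \<noteq> UNIV" "\<Omega> \<noteq> {}" using assms not_bounded_UNIV by auto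
  then obtain f g where fg: "f holomorphic_on \<Omega>"
      "\<And>z. z \<in> \<Omega> \<Longrightarrow> f z \<in> ball 0 1 \<and> g (f z) = z"
      "\<And>w. w \<in> ball 0 1 \<Longrightarrow> g w \<in> \<Omega> \<and> f (g w) = w"
    using simply_connected_eq_biholomorphic_to_disc[OF assms(1)] assms(3) by metis
  have "f z \<in> ball 0 1" using fg(2) assms(4) by blast
  then obtain p q where pq: "p (f z) = 0" "p holomorphic_on ball 0 1" "p ` ball 0 1 \<subseteq> ball 0 1"
      "q ` ball 0 1 \<subseteq> ball 0 1" "\<And>z. z \<in> ball 0 1 \<Longrightarrow> p (q z) = z"
      "\<And>z. z \<in> ball 0 1 \<Longrightarrow> q (p z) = z"
    by (rule ball_biholomorphism_exists) blast
  show ?thesis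
  proof
    show "(\<lambda>z. p (f z)) holomorphic_on \<Omega>"
      using holomorphic_on_compose_gen[OF fg(1) pq(2)] fg(2) by (simp add: o_def image_subset_iff)
    show "inj_on (\<lambda>z. p (f z)) \<Omega>"
      by (rule inj_on_inverseI[of _ "\<lambda>w. g (q w)"]) (use fg(2) pq(6) in auto)
    show "(\<lambda>z. p (f z)) ` \<Omega> = ball 0 1"
    proof (intro equalityI subsetI)
      fix w :: complex assume w: "w \<in> ball 0 1"
      then have "q w \<in> ball 0 1" using pq(4) by blast
      then show "w \<in> (\<lambda>z. p (f z)) ` \<Omega>"
        using fg(3) pq(5) w by (intro image_eqI[of _ _ "g (q w)"]) auto
    qed (use fg(2) pq(3) in blast)
    show "p (f z) = 0" by fact
  qed
qed

section \<open>Products of embeddings and the squeezing function\<close>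

lemma product_embedding:
  assumes op: "open \<Omega>1" "open \<Omega>2"
    and h1: "h1 holomorphic_on \<Omega>1" "inj_on h1 \<Omega>1" "h1 ` \<Omega>1 \<subseteq> ball 0 1"
    and h2: "h2 holomorphic_on \<Omega>2" "inj_on h2 \<Omega>2" "h2 ` \<Omega>2 \<subseteq> ball 0 1"
  shows "holomorphic_embedding (\<lambda>z :: complex ^ 2. vector [h1 (z $ 1), h2 (z $ 2)] :: complex ^ 2)
      (product_domain \<Omega>1 \<Omega>2) (polydisk 1)" (is "holomorphic_embedding ?F ?P _")
  unfolding holomorphic_embedding_def
proof (intro conjI)
  let ?E = "\<lambda>(u, v). vector [u, v] :: complex ^ 2"
  have E: "bounded_linear ?E"
    unfolding linear_conv_bounded_linear[symmetric]
    by (rule linearI) (auto simp: vec_eq_iff forall_2)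
  show "holomorphic_map_on ?F ?P"
    unfolding holomorphic_map_on_def
  proof
    fix z assume "z \<in> ?P"
    then have z: "z $ 1 \<in> \<Omega>1" "z $ 2 \<in> \<Omega>2" by (auto simp: product_domain_def)
    have nth: "((\<lambda>z :: complex ^ 2. z $ i) has_derivative (\<lambda>v. v $ i)) (at z within ?P)" for i
      by (rule bounded_linear_imp_has_derivative[OF bounded_linear_vec_nth])
    have D1: "((\<lambda>z. h1 (z $ 1)) has_derivative (\<lambda>v. deriv h1 (z $ 1) * v $ 1)) (at z within ?P)"
      using has_derivative_compose[OF nth holomorphic_derivI[OF h1(1) op(1) z(1),
            THEN has_field_derivative_imp_has_derivative]] .
    have D2: "((\<lambda>z. h2 (z $ 2)) has_derivative (\<lambda>v. deriv h2 (z $ 2) * v $ 2)) (at z within ?P)"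
      using has_derivative_compose[OF nth holomorphic_derivI[OF h2(1) op(2) z(2),
            THEN has_field_derivative_imp_has_derivative]] .
    have "((\<lambda>z. ?E (h1 (z $ 1), h2 (z $ 2))) has_derivative
        (\<lambda>v. ?E (deriv h1 (z $ 1) * v $ 1, deriv h2 (z $ 2) * v $ 2))) (at z within ?P)"
      by (rule bounded_linear.has_derivative[OF E has_derivative_Pair[OF D1 D2]])
    moreover have "?E (deriv h1 (z $ 1) * (c *s v) $ 1, deriv h2 (z $ 2) * (c *s v) $ 2) =
        c *s ?E (deriv h1 (z $ 1) * v $ 1, deriv h2 (z $ 2) * v $ 2)" for c and v :: "complex ^ 2"
      by (simp add: vec_eq_iff forall_2 mult_ac)
    ultimately show "\<exists>D. (?F has_derivative D) (at z within ?P) \<and> (\<forall>c v. D (c *s v) = c *s D v)"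
      by (auto intro!: exI[of _ "\<lambda>v. ?E (deriv h1 (z $ 1) * v $ 1, deriv h2 (z $ 2) * v $ 2)"])
  qed
  show "inj_on ?F ?P"
    using h1(2) h2(2) unfolding inj_on_def product_domain_def
    by (auto simp: vec_eq_iff forall_2)
  show "?F ` ?P \<subseteq> polydisk 1"
    using h1(3) h2(3) by (auto simp: product_domain_def polydisk_def forall_2)
qed

lemma polydisk_subset_product_image:
  assumes "ball 0 r \<subseteq> h1 ` \<Omega>1" "ball 0 r \<subseteq> h2 ` \<Omega>2"
  shows "polydisk r \<subseteq> (\<lambda>z :: complex ^ 2. vector [h1 (z $ 1), h2 (z $ 2)] :: complex ^ 2) `
    product_domain \<Omega>1 \<Omega>2"
proof
  fix w :: "complex ^ 2" assume "w \<in> polydisk r"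
  then have "w $ 1 \<in> ball 0 r" "w $ 2 \<in> ball 0 r" by (auto simp: polydisk_def)
  then have "w $ 1 \<in> h1 ` \<Omega>1" "w $ 2 \<in> h2 ` \<Omega>2" using assms by blast+
  then obtain x y where xy: "x \<in> \<Omega>1" "h1 x = w $ 1" "y \<in> \<Omega>2" "h2 y = w $ 2"
    by (elim imageE) simp
  then have "vector [x, y] \<in> product_domain \<Omega>1 \<Omega>2"
    by (simp add: product_domain_def)
  moreover have "w = vector [h1 ((vector [x, y] :: complex ^ 2) $ 1),
      h2 ((vector [x, y] :: complex ^ 2) $ 2)]"
    using xy by (simp add: vec_eq_iff forall_2)
  ultimately show "w \<in> (\<lambda>z. vector [h1 (z $ 1), h2 (z $ 2)]) ` product_domain \<Omega>1 \<Omega>2" by blast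
qed

lemma polydisk_squeezing_bounds:
  fixes f :: "complex ^ 'n \<Rightarrow> complex ^ 'n"
  assumes "0 < r" "holomorphic_embedding f S (polydisk 1)" "f z = 0" "polydisk r \<subseteq> f ` S"
  shows "r \<le> polydisk_squeezing S z" "polydisk_squeezing S z \<le> 1"
proof -
  define R where "R = {r. 0 < r \<and> (\<exists>f :: complex ^ 'n \<Rightarrow> complex ^ 'n.
      holomorphic_embedding f S (polydisk 1) \<and> f z = 0 \<and> polydisk r \<subseteq> f ` S)}"
  have S: "polydisk_squeezing S z = Sup R"
    by (simp add: polydisk_squeezing_def R_def)
  have r: "r \<in> R" using assms by (auto simp: R_def)
  then show "r \<le> polydisk_squeezing S z"
    unfolding S R_def by (intro cSup_upper polydisk_squeezing_bdd_above)
  have "t \<le> 1" if "t \<in> R" for t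
  proof (rule ccontr)
    assume "\<not> t \<le> 1"
    then have "(\<chi> i. 1) \<in> (polydisk t :: (complex ^ 'n) set)"
      by (simp add: polydisk_def)
    then have "(\<chi> i. 1) \<in> (polydisk 1 :: (complex ^ 'n) set)"
      using that unfolding R_def holomorphic_embedding_def by blast
    then show False by (simp add: polydisk_def)
  qed
  with r show "polydisk_squeezing S z \<le> 1"
    unfolding S by (intro cSup_least) auto
qed

section \<open>The boundary limit\<close>

theorem theorem2p3:
  fixes \<Omega>1 \<Omega>2 :: "complex set" and \<Omega> :: "(complex ^ 2) set"
  assumes "is_domain \<Omega>1" and "bounded \<Omega>1"
    and "is_domain \<Omega>2" and "bounded \<Omega>2"
    and "\<Omega> = product_domain \<Omega>1 \<Omega>2"
    and "finite (sphere_complement_components \<Omega>1)"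
    and "\<forall>C\<in>sphere_complement_components \<Omega>1. \<not> is_singleton C"
    and "simply_connected \<Omega>2"
  shows "\<forall>z2\<in>\<Omega>2.
    ((\<lambda>z1. polydisk_squeezing \<Omega> (vector [z1, z2])) \<longlongrightarrow> 1) (to_boundary \<Omega>1)"
proof
  fix z2 assume z2: "z2 \<in> \<Omega>2"
  have \<Omega>1: "open \<Omega>1" "connected \<Omega>1" "bounded \<Omega>1" "\<Omega>1 \<noteq> {}"
    using assms(1,2) by (auto simp: is_domain_def)
  have \<Omega>2: "open \<Omega>2" using assms(3) by (simp add: is_domain_def)
  have fin: "finite (components (- \<Omega>1))"
    using finite_complement_components \<Omega>1 assms(6) by blast
  have ns: "\<And>A. A \<in> components (- \<Omega>1) \<Longrightarrow> \<not> is_singleton A"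
    using complement_component_not_singleton[OF \<Omega>1(1,3) assms(7)] .
  obtain h2 where h2: "h2 holomorphic_on \<Omega>2" "inj_on h2 \<Omega>2" "h2 ` \<Omega>2 = ball 0 1" "h2 z2 = 0"
    using simply_connected_disc_embedding[OF \<Omega>2 assms(4,8) z2] .
  show "((\<lambda>z1. polydisk_squeezing \<Omega> (vector [z1, z2])) \<longlongrightarrow> 1) (to_boundary \<Omega>1)"
  proof (rule tendstoI)
    fix e :: real assume "e > 0"
    \<comment> \<open>the maximum only ensures that \<open>r\<close> is positive\<close>
    define r where "r = max (1 / 2) (1 - e / 2)"
    have r: "0 < r" "r < 1" "1 - r < e" using \<open>e > 0\<close> by (auto simp: r_def)
    obtain d where d: "d > 0" "\<And>z. z \<in> \<Omega>1 \<Longrightarrow> infdist z (frontier \<Omega>1) < d \<Longrightarrow>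
        \<exists>h. h holomorphic_on \<Omega>1 \<and> inj_on h \<Omega>1 \<and> h ` \<Omega>1 \<subseteq> ball 0 1 \<and> h z = 0 \<and> ball 0 r \<subseteq> h ` \<Omega>1"
      using disc_embedding_near_frontier[OF \<Omega>1 fin ns r(2)] by blast
    have "dist (polydisk_squeezing \<Omega> (vector [z1, z2])) 1 < e"
      if z1: "z1 \<in> \<Omega>1" "infdist z1 (frontier \<Omega>1) < d" for z1
    proof -
      obtain h1 where h1: "h1 holomorphic_on \<Omega>1" "inj_on h1 \<Omega>1" "h1 ` \<Omega>1 \<subseteq> ball 0 1"
          "h1 z1 = 0" "ball 0 r \<subseteq> h1 ` \<Omega>1"
        using d(2)[OF z1] by blast
      let ?F = "\<lambda>z :: complex ^ 2. vector [h1 (z $ 1), h2 (z $ 2)] :: complex ^ 2"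
      have "holomorphic_embedding ?F \<Omega> (polydisk 1)"
        unfolding assms(5) using product_embedding[OF \<Omega>1(1) \<Omega>2 h1(1-3) h2(1,2)] h2(3) by simp
      moreover have "?F (vector [z1, z2]) = 0"
        using h1(4) h2(4) by (simp add: vec_eq_iff forall_2)
      moreover have "polydisk r \<subseteq> ?F ` \<Omega>"
        unfolding assms(5) using h1(5) h2(3) r by (intro polydisk_subset_product_image) auto
      ultimately have "r \<le> polydisk_squeezing \<Omega> (vector [z1, z2])"
          "polydisk_squeezing \<Omega> (vector [z1, z2]) \<le> 1"
        using polydisk_squeezing_bounds[OF r(1)] by blast+
      with r(3) show ?thesis by (simp add: dist_real_def)
    qed
    with d(1) show "\<forall>\<^sub>F z1 in to_boundary \<Omega>1. dist (polydisk_squeezing \<Omega> (vector [z1, z2])) 1 < e"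
      unfolding eventually_to_boundary by blast
  qed
qed

end
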